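(* Let $m\geq 1$ be an integer and let $K_{1,m}$ be the star with $m$ leaves. Then $$\chi_{td}(K_{1,m})=\begin{cases} m+1, & m \text{ even},\\ m+2, & m\text{ odd}.\end{cases}$$
   Context: Graphs are finite, simple and undirected. A total labeling of a graph $G$ is a function $f:V(G)\cup E(G)\to\mathbb{Z}^+$ (positive integers) such that $f(u)\neq f(v)$ for adjacent vertices $u,v$; $f(\{u,v\})\neq f(\{v,w\})$ for any two distinct incident edges $\{u,v\},\{v,w\}$; and $f(u)\neq f(\{u,v\})$ for every edge $\{u,v\}$ and incident vertex $u$. It is a $k$-total labeling if the maximum label assigned to any vertex or edge is $k$. A $k$-total difference labeling is a $k$-total labeling $f$ with $f(\{u,v\})=|f(u)-f(v)|$ for every edge $\{u,v\}$. The total difference chromatic number $\chi_{td}(G)$ is the smallest integer $k$ for which $G$ has a $k$-total difference labeling. *)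

theory Defs
  imports Main
begin

record 'a ugraph =
  verts :: "'a set"
  edges :: "'a set set"

definition simple_graph :: "'a ugraph \<Rightarrow> bool" where
  "simple_graph G \<longleftrightarrow> finite (verts G) \<and>
     (\<forall>e\<in>edges G. \<exists>u\<in>verts G. \<exists>v\<in>verts G. u \<noteq> v \<and> e = {u, v})"

text \<open>A total labeling is defined on the disjoint union of vertices and edges: \<open>f (Inl u)\<close> is the
  label of the vertex \<open>u\<close> and \<open>f (Inr e)\<close> that of the edge \<open>e\<close>. Values of \<open>f\<close> outside
  \<open>verts G <+> edges G\<close> are irrelevant.\<close>

definition total_labeling :: "'a ugraph \<Rightarrow> ('a + 'a set \<Rightarrow> nat) \<Rightarrow> bool" where
  "total_labeling G f \<longleftrightarrow>
     (\<forall>x\<in>verts G <+> edges G. f x > 0) \<and>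
     (\<forall>u v. {u, v} \<in> edges G \<longrightarrow> f (Inl u) \<noteq> f (Inl v)) \<and>
     (\<forall>u v w. {u, v} \<in> edges G \<and> {v, w} \<in> edges G \<and> {u, v} \<noteq> {v, w}
        \<longrightarrow> f (Inr {u, v}) \<noteq> f (Inr {v, w})) \<and>
     (\<forall>u v. {u, v} \<in> edges G \<longrightarrow> f (Inl u) \<noteq> f (Inr {u, v}))"

definition k_total_labeling :: "'a ugraph \<Rightarrow> nat \<Rightarrow> ('a + 'a set \<Rightarrow> nat) \<Rightarrow> bool" where
  "k_total_labeling G k f \<longleftrightarrow> total_labeling G f \<and> Max (f ` (verts G <+> edges G)) = k"

definition k_total_difference_labeling :: "'a ugraph \<Rightarrow> nat \<Rightarrow> ('a + 'a set \<Rightarrow> nat) \<Rightarrow> bool" where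
  "k_total_difference_labeling G k f \<longleftrightarrow> k_total_labeling G k f \<and>
     (\<forall>u v. {u, v} \<in> edges G \<longrightarrow>
        int (f (Inr {u, v})) = \<bar>int (f (Inl u)) - int (f (Inl v))\<bar>)"

definition chi_td :: "'a ugraph \<Rightarrow> nat" where
  "chi_td G = (LEAST k. \<exists>f. k_total_difference_labeling G k f)"

text \<open>\<open>G\<close> is a copy of the complete bipartite graph \<open>K\<^bsub>p,q\<^esub>\<close>; for \<open>p = 1\<close> this is the star with
  \<open>q\<close> leaves.\<close>

definition is_complete_bipartite :: "nat \<Rightarrow> nat \<Rightarrow> 'a ugraph \<Rightarrow> bool" where
  "is_complete_bipartite p q G \<longleftrightarrow>
     (\<exists>A B. finite A \<and> finite B \<and> card A = p \<and> card B = q \<and> A \<inter> B = {} \<and>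
        verts G = A \<union> B \<and> edges G = {{a, b} | a b. a \<in> A \<and> b \<in> B})"

lemma simple_graph_complete_bipartite:
  "is_complete_bipartite p q G \<Longrightarrow> simple_graph G"
  unfolding is_complete_bipartite_def simple_graph_def by fastforce

lemma complete_bipartite_exists: "\<exists>G :: nat ugraph. is_complete_bipartite p q G"
proof -
  define A B where "A = {..<p}" and "B = {p..<p + q}"
  have "is_complete_bipartite p q
      \<lparr>verts = A \<union> B, edges = {{a, b} | a b. a \<in> A \<and> b \<in> B}\<rparr>"
    unfolding is_complete_bipartite_def
    by (rule exI[of _ A], rule exI[of _ B]) (auto simp: A_def B_def)
  then show ?thesis ..
qed

end

theory Submission
  imports Defs
begin

text \<open>The differences on the edges are distinct, so the leaves carry distinct labels, none equal to
  the label \<open>c\<close> of the centre; hence \<open>m + 1\<close> labels are needed. If \<open>m + 1\<close> labels suffice, the leaves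
  use every label but \<open>c\<close>. The labels \<open>c - 1\<close> and \<open>c + 1\<close> would give equal differences, so \<open>c\<close> is \<open>1\<close>
  or \<open>m + 1\<close>. A leaf labeled \<open>2 * c\<close> has difference \<open>c\<close>, which excludes \<open>c = 1\<close>, and a leaf labeled
  \<open>c div 2\<close> with \<open>c\<close> even has its own label as difference, so \<open>c = m + 1\<close> is odd.
  Conversely, an odd \<open>c > m\<close> at the centre and \<open>1, \<dots>, m\<close> at the leaves always work.\<close>

lemma is_complete_bipartite_1E:
  assumes "is_complete_bipartite 1 m G"
  obtains a B where "finite B" "card B = m" "a \<notin> B"
    "verts G = insert a B" "edges G = (\<lambda>b. {a, b}) ` B"
proof -
  from assms obtain A B where AB: "finite B" "card A = 1" "card B = m" "A \<inter> B = {}"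
      "verts G = A \<union> B" "edges G = {{a, b} | a b. a \<in> A \<and> b \<in> B}"
    unfolding is_complete_bipartite_def by (elim exE conjE)
  obtain a where "A = {a}"
    using AB(2) card_1_singletonE by blast
  show thesis
  proof (rule that)
    show "a \<notin> B" "verts G = insert a B" "edges G = (\<lambda>b. {a, b}) ` B"
      using AB(4-6) \<open>A = {a}\<close> by auto
  qed (fact AB)+
qed

lemma star_total_difference_labeling_bound:
  assumes star: "is_complete_bipartite 1 m G" and m: "m \<ge> 1"
    and f: "k_total_difference_labeling G k f"
  shows "(if even m then m + 1 else m + 2) \<le> k"
proof -
  obtain a B where B: "finite B" "card B = m" "a \<notin> B"
      and V: "verts G = insert a B" and E: "edges G = (\<lambda>b. {a, b}) ` B"
    using star by (rule is_complete_bipartite_1E)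
  define c where "c = f (Inl a)"
  define x where "x b = f (Inl b)" for b
  have T: "total_labeling G f" and k: "Max (f ` (verts G <+> edges G)) = k"
    and diff: "\<And>u v. {u, v} \<in> edges G \<Longrightarrow>
        int (f (Inr {u, v})) = \<bar>int (f (Inl u)) - int (f (Inl v))\<bar>"
    using f unfolding k_total_difference_labeling_def k_total_labeling_def by auto
  have edge: "{a, b} \<in> edges G" "{b, a} \<in> edges G" if "b \<in> B" for b
    using that E by (auto simp: insert_commute)
  have fin: "finite (f ` (verts G <+> edges G))"
    using B(1) V E by simp
  have pos: "f (Inl v) > 0" and le: "f (Inl v) \<le> k" if "v \<in> insert a B" for v
    using that T V Max_ge[OF fin] k unfolding total_labeling_def by (auto intro: InlI)
  have d: "int (f (Inr {a, b})) = \<bar>int c - int (x b)\<bar>" if "b \<in> B" for b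
    using diff[OF edge(1)[OF that]] by (simp add: c_def x_def)
  have ne_c: "x b \<noteq> c" if "b \<in> B" for b
    using T edge[OF that] unfolding total_labeling_def c_def x_def by metis
  have ne_double: "x b \<noteq> 2 * c" if "b \<in> B" for b
  proof -
    have "c \<noteq> f (Inr {a, b})"
      using T edge[OF that] unfolding total_labeling_def c_def by metis
    then show ?thesis using d[OF that] by auto
  qed
  have ne_half: "2 * x b \<noteq> c" if "b \<in> B" for b
  proof -
    have "x b \<noteq> f (Inr {b, a})"
      using T edge[OF that] unfolding total_labeling_def x_def by metis
    then show ?thesis using d[OF that] by (auto simp: insert_commute)
  qed
  have dist: "\<bar>int c - int (x b)\<bar> \<noteq> \<bar>int c - int (x b')\<bar>"
    if b: "b \<in> B" and b': "b' \<in> B" and "b \<noteq> b'" for b b'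
  proof -
    \<comment> \<open>The condition on incident edges is stated for a path \<open>u\<close>,
      \<open>v\<close>, \<open>w\<close>; this orientation puts the centre \<open>a\<close> in the
      middle.\<close>
    have "{b, a} \<noteq> {a, b'}"
      using that B(3) by (auto simp: doubleton_eq_iff)
    with T edge[OF b] edge[OF b'] have "f (Inr {b, a}) \<noteq> f (Inr {a, b'})"
      unfolding total_labeling_def by blast
    then show ?thesis
      using d[OF b] d[OF b'] by (simp add: insert_commute)
  qed
  have "inj_on x B"
    using dist by (metis inj_onI)
  then have card_x: "card (x ` B) = m"
    using B(2) by (simp add: card_image)
  have c: "1 \<le> c" "c \<le> k"
    using pos[of a] le[of a] by (auto simp: c_def)
  have sub: "x ` B \<subseteq> {1..k} - {c}"
    using pos le ne_c by (fastforce simp: x_def)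
  have card_k: "card ({1..k} - {c}) = k - 1"
    using c by simp
  have "m \<le> k - 1"
    using card_mono[OF _ sub] card_x card_k by simp
  moreover have "even m" if "k = m + 1"
  proof -
    have all: "x ` B = {1..k} - {c}"
      using card_subset_eq[OF _ sub] card_x card_k that by simp
    have "c \<noteq> 1"
    proof
      assume "c = 1"
      \<comment> \<open>As \<open>m\<close> is positive, \<open>k = m + 1\<close> is at least 2, so
        the label 2 is available and must sit on a leaf.\<close>
      then have "2 \<in> x ` B" using all that m by auto
      then show False using ne_double \<open>c = 1\<close> by force
    qed
    have "c = k"
    proof (rule ccontr)
      assume "c \<noteq> k"
      then have "c - 1 \<in> x ` B" "c + 1 \<in> x ` B"
        using all c \<open>c \<noteq> 1\<close> by auto
      then obtain b b' where bb': "b \<in> B" "x b = c - 1" "b' \<in> B" "x b' = c + 1"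
        by (metis imageE)
      then have "b \<noteq> b'" by auto
      then show False using dist[of b b'] bb' c by simp
    qed
    have "odd c"
    proof
      assume "even c"
      \<comment> \<open>An even \<open>c\<close> is at least 2, so its half is a positive label
        other than \<open>c\<close>.\<close>
      then have "c div 2 \<in> x ` B" "2 * (c div 2) = c" using all c by auto
      then show False using ne_half by (metis imageE)
    qed
    then show ?thesis using \<open>c = k\<close> that by simp
  qed
  \<comment> \<open>As \<open>k\<close> is positive, \<open>m \<le> k - 1\<close> gives
    \<open>m + 1 \<le> k\<close>. Equality forces \<open>m\<close> even; otherwise \<open>k\<close>
    is at least \<open>m + 2\<close>, enough for either parity.\<close>
  ultimately show ?thesis using c m by (cases "k = m + 1") auto
qed

text \<open>Leaf labels and differences all lie strictly between 0 and \<open>c\<close>, so only a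
  leaf can clash with its edge, which would need \<open>2 * h b = c\<close>; oddness of
  \<open>c\<close> forbids it. Leaving \<open>c\<close> free serves both parities:
  \<open>m + 1\<close> for even \<open>m\<close>, \<open>m + 2\<close> for odd
  \<open>m\<close>.\<close>

lemma star_total_difference_labeling_exists:
  assumes star: "is_complete_bipartite 1 m G" and c: "odd c" "m < c"
  shows "\<exists>f. k_total_difference_labeling G c f"
proof -
  obtain a B where B: "finite B" "card B = m" "a \<notin> B"
      and V: "verts G = insert a B" and E: "edges G = (\<lambda>b. {a, b}) ` B"
    using star by (rule is_complete_bipartite_1E)
  obtain g where g: "bij_betw g B {0..<m}"
    using ex_bij_betw_finite_nat[OF B(1)] B(2) by auto
  define h where "h v = (if v = a then c else g v + 1)" for v
  \<comment> \<open>An edge is an unordered set, so the absolute difference of its end labels is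
    expressed as maximum minus minimum.\<close>
  define f where "f = case_sum h (\<lambda>e. Max (h ` e) - Min (h ` e))"
  have ha: "h a = c"
    by (simp add: h_def)
  have hB: "0 < h b" "h b < c" "2 * h b \<noteq> c" if "b \<in> B" for b
    using bij_betw_apply[OF g that] that B(3) c by (auto simp: h_def)
  have inj: "b = b'" if "b \<in> B" "b' \<in> B" "h b = h b'" for b b'
    using that g B(3) by (auto simp: h_def bij_betw_def inj_on_def split: if_splits)
  have fl: "f (Inl v) = h v" for v
    by (simp add: f_def)
  have fr: "f (Inr {a, b}) = c - h b" if "b \<in> B" for b
    using hB[OF that] by (simp add: f_def ha)
  have edgeE: "\<exists>b\<in>B. {u, v} = {a, b} \<and> (u = a \<and> v = b \<or> u = b \<and> v = a)"
    if "{u, v} \<in> edges G" for u v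
    using that E by (auto simp: doubleton_eq_iff)
  have "total_labeling G f"
    unfolding total_labeling_def
  proof (intro conjI ballI allI impI)
    fix z assume "z \<in> verts G <+> edges G"
    then show "f z > 0"
      using V E fl fr hB ha c by auto
  next
    fix u v assume "{u, v} \<in> edges G"
    from edgeE[OF this] show "f (Inl u) \<noteq> f (Inl v)"
      using fl hB ha by fastforce
  next
    fix u v w assume "{u, v} \<in> edges G \<and> {v, w} \<in> edges G \<and> {u, v} \<noteq> {v, w}"
    then obtain b b' where b: "b \<in> B" "{u, v} = {a, b}" "b' \<in> B" "{v, w} = {a, b'}" "b \<noteq> b'"
      using edgeE by metis
    then have "h b \<noteq> h b'" using inj by blast
    then show "f (Inr {u, v}) \<noteq> f (Inr {v, w})"
      \<comment> \<open>Both leaf labels are below \<open>c\<close>, so the truncated differences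
        from \<open>c\<close> stay distinct.\<close>
      using b fr hB(2)[of b] hB(2)[of b'] by simp
  next
    fix u v assume "{u, v} \<in> edges G"
    from edgeE[OF this] obtain b where b: "b \<in> B" "{u, v} = {a, b}" "u = a \<or> u = b" by blast
    then show "f (Inl u) \<noteq> f (Inr {u, v})"
      using fl fr[OF b(1)] hB[OF b(1)] ha by auto
  qed
  moreover have "Max (f ` (verts G <+> edges G)) = c"
  proof (rule Max_eqI)
    show "finite (f ` (verts G <+> edges G))"
      using B(1) V E by simp
    show "y \<le> c" if "y \<in> f ` (verts G <+> edges G)" for y
      using that V E fl fr hB(2) ha by (auto simp: less_imp_le)
    \<comment> \<open>The maximum is attained at the centre, even when
      \<open>c = m + 2\<close>.\<close>
    show "c \<in> f ` (verts G <+> edges G)"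
      using V fl ha by (metis InlI image_eqI insertI1)
  qed
  moreover have "int (f (Inr {u, v})) = \<bar>int (f (Inl u)) - int (f (Inl v))\<bar>"
    if uv: "{u, v} \<in> edges G" for u v
  proof -
    from edgeE[OF uv] obtain b where b: "b \<in> B" "{u, v} = {a, b}"
      "u = a \<and> v = b \<or> u = b \<and> v = a" by blast
    then show ?thesis
      using fl fr[OF b(1)] hB[OF b(1)] ha by auto
  qed
  ultimately show ?thesis
    unfolding k_total_difference_labeling_def k_total_labeling_def by blast
qed

theorem theorem4p1:
  fixes m :: nat and G :: "'a ugraph"
  assumes "m \<ge> 1" and "is_complete_bipartite 1 m G"
  shows "chi_td G = (if even m then m + 1 else m + 2)"
  unfolding chi_td_def
proof (rule Least_equality)
  show "\<exists>f. k_total_difference_labeling G (if even m then m + 1 else m + 2) f"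
    by (rule star_total_difference_labeling_exists[OF assms(2)]) auto
  show "(if even m then m + 1 else m + 2) \<le> k"
    if "\<exists>f. k_total_difference_labeling G k f" for k
    using that star_total_difference_labeling_bound[OF assms(2,1)] by blast
qed

end
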